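(* Suppose that the penalty $J$ satisfies $$J(uv)\le J(u)+J(v),\qquad J(u)=J\left(\frac1u\right),\qquad J(1)=0\qquad\text{for any }u,v\in\operatorname{dom}J,$$ that $H(f^\delta,f)\le\delta^2$ with $\delta>0$, that $(a_k)_{k\ge0}$ is a sequence of nonnegative numbers with $\lim_{k\to\infty}a_k=0$ and $a_k\le a_{k-1}$ for any $k\ge1$, that $(\lambda_k)_{k\ge0}\subset(0,\infty)$ satisfies $2\lambda_k\le\lambda_{k+1}$ for $k\ge0$, and that the iterates $x_k$ of the tight multiplicative multiscale hierarchical decomposition method (MHDM) are well-defined. Then the following estimate holds for any $k\ge0$: $$H(f^\delta,Tx_k)+a_kJ(x_k)\le\delta^2+\left(\sum_{j=0}^ka_j\right)\frac{J(z)}{k+1}+\frac{2J(z)}{(k+1)\lambda_0}.$$ Moreover, if $\sum_{k=0}^\infty a_k<\infty$, then the stopping index defined, for some $\tau>1$, by $$k^*(\delta):=\max\{k\in\mathbb{N}:\ H(f^\delta,Tx_k)+a_kJ(x_k)\ge\tau\delta^2\}$$ is finite. Additionally (under the same summability assumption): 1. If $(k^*(\delta))$ is unbounded, then $\lim_{\delta\to0}H(f^\delta,Tx_{k^*(\delta)})=0$ and $\lim_{\delta\to0}a_{k^*(\delta)}J(x_{k^*(\delta)})=0$. 2. If the stopping index is chosen as $k^*(\delta)\sim\frac1{\delta^2}$, then $H(f^\delta,Tx_{k^*(\delta)})+a_{k^*(\delta)}J(x_{k^*(\delta)})=O(\delta^2)$.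
   Context: $\Omega\subseteq\mathbb{R}^2$ is a domain, $T:L^2(\Omega)\to L^2(\Omega)$ is a bounded linear operator, $f\in L^2(\Omega)$ is the exact data, $f^\delta$ is the noisy data for noise level $\delta>0$, and $z$ is a clean image satisfying $Tz=f$ and $J(z)<\infty$, where $J:L^2(\Omega)\to[0,\infty]$ is a proper function (the penalty) and $\operatorname{dom}J=\{u\in L^2(\Omega):J(u)<\infty\}$. The assumed properties of $J$ are understood to include that $uv$ and $1/u$ make sense and belong to $\operatorname{dom}J$ for $u,v\in\operatorname{dom}J$. $H$ is a non-negative data fitting term. $BV(\Omega)$ is the space of functions of bounded variation on $\Omega$. The quantities $f,z,T,J,H,(\lambda_k),(a_k),\tau$ do not depend on $\delta$. Tight multiplicative MHDM (for given $f^\delta$): set $x_{-1}=1$ and, for $k\ge0$, $x_k=\prod_{j=0}^{k}u_j$, where $u_k\in BV(\Omega)$ is determined as a solution of $$\min_uF_k(u),\qquad F_k(u)=\lambda_kH(f^\delta,T(ux_{k-1}))+\lambda_ka_kJ(ux_{k-1})+J(u).$$ "The iterates are well-defined" means that for every $k\ge0$ such a solution $u_k$ exists (not necessarily unique; some choice is fixed) and all expressions $Tx_k$, $H(f^\delta,Tx_k)$ make sense. The finiteness of $k^*(\delta)$ means that the set of indices defining it is bounded above; $k^*(\delta)\sim1/\delta^2$ means that $k^*(\delta)$ is of the order of $1/\delta^2$ as $\delta\to0$.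
   Formalization: In item 1, "unbounded" is read as k*(δ)→∞ as δ→0 for the full limits; if k*(δ) is merely unbounded, the limits are claimed only along some null sequence of noise levels on which k*→∞, since the full limits can then fail. *)

theory Defs
  imports "HOL-Analysis.Analysis" "HOL-Library.Landau_Symbols"
begin

text \<open>
  Elements of $L^2(\Omega)$ are represented by square-integrable functions; two representatives
  are identified if they agree almost everywhere in $\Omega$. Operators and functionals on
  $L^2(\Omega)$ act on representatives and are required to respect this identification.
\<close>

type_synonym image = "real^2 \<Rightarrow> real"

definition L2 :: "(real^2) set \<Rightarrow> image set" where
  "L2 \<Omega> = {u \<in> borel_measurable (lebesgue_on \<Omega>). integrable (lebesgue_on \<Omega>) (\<lambda>p. (u p)\<^sup>2)}"

definition L2_norm :: "(real^2) set \<Rightarrow> image \<Rightarrow> real" where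
  "L2_norm \<Omega> u = sqrt (LINT p|lebesgue_on \<Omega>. (u p)\<^sup>2)"

definition ae_eq :: "(real^2) set \<Rightarrow> image \<Rightarrow> image \<Rightarrow> bool" where
  "ae_eq \<Omega> u v \<longleftrightarrow> (AE p in lebesgue_on \<Omega>. u p = v p)"

definition bounded_linear_L2 :: "(real^2) set \<Rightarrow> (image \<Rightarrow> image) \<Rightarrow> bool" where
  "bounded_linear_L2 \<Omega> T \<longleftrightarrow>
     (\<forall>u\<in>L2 \<Omega>. T u \<in> L2 \<Omega>) \<and>
     (\<forall>u\<in>L2 \<Omega>. \<forall>v\<in>L2 \<Omega>. ae_eq \<Omega> u v \<longrightarrow> ae_eq \<Omega> (T u) (T v)) \<and>
     (\<forall>u\<in>L2 \<Omega>. \<forall>v\<in>L2 \<Omega>. ae_eq \<Omega> (T (\<lambda>p. u p + v p)) (\<lambda>p. T u p + T v p)) \<and>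
     (\<forall>c. \<forall>u\<in>L2 \<Omega>. ae_eq \<Omega> (T (\<lambda>p. c * u p)) (\<lambda>p. c * T u p)) \<and>
     (\<exists>C. \<forall>u\<in>L2 \<Omega>. L2_norm \<Omega> (T u) \<le> C * L2_norm \<Omega> u)"

definition functional_on_L2 :: "(real^2) set \<Rightarrow> (image \<Rightarrow> ennreal) \<Rightarrow> bool" where
  "functional_on_L2 \<Omega> J \<longleftrightarrow>
     (\<forall>u\<in>L2 \<Omega>. \<forall>v\<in>L2 \<Omega>. ae_eq \<Omega> u v \<longrightarrow> J u = J v)"

definition data_fitting_on_L2 :: "(real^2) set \<Rightarrow> (image \<Rightarrow> image \<Rightarrow> ennreal) \<Rightarrow> bool" where
  "data_fitting_on_L2 \<Omega> H \<longleftrightarrow>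
     (\<forall>g\<in>L2 \<Omega>. \<forall>g'\<in>L2 \<Omega>. \<forall>h\<in>L2 \<Omega>. \<forall>h'\<in>L2 \<Omega>.
        ae_eq \<Omega> g g' \<longrightarrow> ae_eq \<Omega> h h' \<longrightarrow> H g h = H g' h')"

definition dom_L2 :: "(real^2) set \<Rightarrow> (image \<Rightarrow> ennreal) \<Rightarrow> image set" where
  "dom_L2 \<Omega> J = {u \<in> L2 \<Omega>. J u < \<infinity>}"

text \<open>
  Vector fields in $C^1_c(\Omega;\mathbb{R}^2)$, extended by zero to the whole plane.
\<close>

definition C1c_field :: "(real^2) set \<Rightarrow> (real^2 \<Rightarrow> real^2) \<Rightarrow> bool" where
  "C1c_field \<Omega> \<phi> \<longleftrightarrow>
     (\<forall>p. \<phi> differentiable at p) \<and>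
     continuous_on UNIV (\<lambda>p. jacobian \<phi> (at p)) \<and>
     compact (closure {p. \<phi> p \<noteq> 0}) \<and> closure {p. \<phi> p \<noteq> 0} \<subseteq> \<Omega>"

definition divergence :: "(real^2 \<Rightarrow> real^2) \<Rightarrow> real^2 \<Rightarrow> real" where
  "divergence \<phi> p = trace (jacobian \<phi> (at p))"

definition BV :: "(real^2) set \<Rightarrow> image set" where
  "BV \<Omega> = {u. integrable (lebesgue_on \<Omega>) u \<and>
     bdd_above {LINT p|lebesgue_on \<Omega>. u p * divergence \<phi> p | \<phi>.
       C1c_field \<Omega> \<phi> \<and> (\<forall>p. norm (\<phi> p) \<le> 1)}}"

definition iterate :: "(nat \<Rightarrow> image) \<Rightarrow> nat \<Rightarrow> image" where
  "iterate u k p = (\<Prod>j\<le>k. u j p)"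

text \<open>
  \<open>prev_iterate u k\<close> is $x_{k-1}$; for $k = 0$ the product is empty, which gives $x_{-1} = 1$.
\<close>

definition prev_iterate :: "(nat \<Rightarrow> image) \<Rightarrow> nat \<Rightarrow> image" where
  "prev_iterate u k p = (\<Prod>j<k. u j p)"

definition tight_functional ::
  "(image \<Rightarrow> image) \<Rightarrow> (image \<Rightarrow> ennreal) \<Rightarrow> (image \<Rightarrow> image \<Rightarrow> ennreal) \<Rightarrow> image
    \<Rightarrow> real \<Rightarrow> real \<Rightarrow> image \<Rightarrow> image \<Rightarrow> ennreal" where
  "tight_functional T J H g l c x v =
     ennreal l * H g (T (\<lambda>p. v p * x p)) + ennreal l * ennreal c * J (\<lambda>p. v p * x p) + J v"

text \<open>
  The minimisation in step $k$ is over all $v \in L^2(\Omega)$ for which the functional is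
  meaningful, that is, with $v x_{k-1} \in L^2(\Omega)$; the minimiser $u_k$ lies in $BV(\Omega)$.
  Minimisers need not be unique; the predicate says that \<open>u\<close> is one possible choice.
\<close>

definition tight_mhdm ::
  "(real^2) set \<Rightarrow> (image \<Rightarrow> image) \<Rightarrow> (image \<Rightarrow> ennreal) \<Rightarrow> (image \<Rightarrow> image \<Rightarrow> ennreal)
    \<Rightarrow> (nat \<Rightarrow> real) \<Rightarrow> (nat \<Rightarrow> real) \<Rightarrow> image \<Rightarrow> (nat \<Rightarrow> image) \<Rightarrow> bool" where
  "tight_mhdm \<Omega> T J H lam a g u \<longleftrightarrow>
     (\<forall>k. u k \<in> BV \<Omega> \<and> u k \<in> L2 \<Omega> \<and> iterate u k \<in> L2 \<Omega> \<and>
        (\<forall>v\<in>L2 \<Omega>. (\<lambda>p. v p * prev_iterate u k p) \<in> L2 \<Omega> \<longrightarrow>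
           tight_functional T J H g (lam k) (a k) (prev_iterate u k) (u k)
             \<le> tight_functional T J H g (lam k) (a k) (prev_iterate u k) v))"

definition tight_residual ::
  "(image \<Rightarrow> image) \<Rightarrow> (image \<Rightarrow> ennreal) \<Rightarrow> (image \<Rightarrow> image \<Rightarrow> ennreal)
    \<Rightarrow> (nat \<Rightarrow> real) \<Rightarrow> image \<Rightarrow> (nat \<Rightarrow> image) \<Rightarrow> nat \<Rightarrow> ennreal" where
  "tight_residual T J H a g u k =
     H g (T (iterate u k)) + ennreal (a k) * J (iterate u k)"

definition stopping_set ::
  "(image \<Rightarrow> image) \<Rightarrow> (image \<Rightarrow> ennreal) \<Rightarrow> (image \<Rightarrow> image \<Rightarrow> ennreal)
    \<Rightarrow> (nat \<Rightarrow> real) \<Rightarrow> image \<Rightarrow> (nat \<Rightarrow> image) \<Rightarrow> real \<Rightarrow> real \<Rightarrow> nat set" where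
  "stopping_set T J H a g u \<tau> \<delta> =
     {k. tight_residual T J H a g u k \<ge> ennreal (\<tau> * \<delta>\<^sup>2)}"

text \<open>
  The stopping index is the maximum of the stopping set, with the convention $0$ if no index
  satisfies the inequality. For an infinite set the value is meaningless.
\<close>

definition stopping_index ::
  "(image \<Rightarrow> image) \<Rightarrow> (image \<Rightarrow> ennreal) \<Rightarrow> (image \<Rightarrow> image \<Rightarrow> ennreal)
    \<Rightarrow> (nat \<Rightarrow> real) \<Rightarrow> image \<Rightarrow> (nat \<Rightarrow> image) \<Rightarrow> real \<Rightarrow> real \<Rightarrow> nat" where
  "stopping_index T J H a g u \<tau> \<delta> =
     (if stopping_set T J H a g u \<tau> \<delta> = {} then 0 else Max (stopping_set T J H a g u \<tau> \<delta>))"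

end

theory Submission
  imports Defs
begin

text \<open>
  Comparing $u_k$ with $z/x_{k-1}$ gives
  $\lambda_k E_k + J(u_k) \le \lambda_k(\delta^2 + a_k J(z)) + A_k$, where $E_k$ is the residual and
  $A_k = J(z/x_{k-1})$. Since $A_{k+1} \le A_k + J(u_k)$ and $2\lambda_k \le \lambda_{k+1}$, the
  quantities $A_{k+1}/\lambda_k$ telescope and bound $\sum_{j\le k} E_j$. Comparing $u_k$ with $1$
  shows that $E_k$ is decreasing, so $(k+1)E_k$ is at most this sum.
\<close>

section \<open>Real-sequence telescoping and auxiliary facts\<close>

text \<open>Separates the arithmetic from the extended-valued functionals. In the application
  \<open>E\<close> is the residual, \<open>B k\<close> is J(u_k), \<open>A k\<close> is
  J(z/x_{k-1}), \<open>d\<close> is the squared noise level and \<open>c\<close> is J(z).\<close>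

lemma decseq_telescope_bound:
  fixes E A B a lam :: "nat \<Rightarrow> real"
  assumes step: "\<And>k. lam k * E k + B k \<le> lam k * (d + a k * c) + A k"
    and A_Suc: "\<And>k. A (Suc k) \<le> A k + B k"
    and A_nonneg: "\<And>k. 0 \<le> A k"
    and E_dec: "decseq E"
    and lam_pos: "\<And>k. 0 < lam k"
    and lam_growth: "\<And>k. 2 * lam k \<le> lam (Suc k)"
  shows "E k \<le> d + (\<Sum>j\<le>k. a j) * (c / real (k + 1)) + 2 * A 0 / (real (k + 1) * lam 0)"
proof -
  \<comment> \<open>\<open>A_Suc\<close> trades \<open>B k\<close> for \<open>A (Suc k)\<close> at
    the price of a second copy of \<open>A k\<close>; this is the origin of the factor 2 in the
    final bound.\<close>
  have one: "E k + A (Suc k) / lam k \<le> d + a k * c + 2 * A k / lam k" for k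
  proof -
    have "lam k * E k + A (Suc k) \<le> lam k * (d + a k * c) + 2 * A k"
      using step[of k] A_Suc[of k] by linarith
    then have "(lam k * E k + A (Suc k)) / lam k \<le> (lam k * (d + a k * c) + 2 * A k) / lam k"
      using lam_pos[of k] by (simp add: divide_right_mono)
    then show ?thesis
      using lam_pos[of k] by (simp add: add_divide_distrib)
  qed
  have sum_le: "(\<Sum>j\<le>k. E j) + A (Suc k) / lam k
      \<le> real (k + 1) * d + (\<Sum>j\<le>k. a j) * c + 2 * A 0 / lam 0" for k
  proof (induction k)
    case 0
    then show ?case using one[of 0] by simp
  next
    case (Suc k)
    \<comment> \<open>Doubling of \<open>lam\<close> compensates the factor 2: the new term on the
      right is absorbed by \<open>A (Suc k) / lam k\<close>, which the induction hypothesis keeps on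
      the left.\<close>
    have "2 * A (Suc k) / lam (Suc k) \<le> 2 * A (Suc k) / (2 * lam k)"
      by (intro divide_left_mono mult_pos_pos lam_growth) (auto simp: A_nonneg lam_pos)
    then have "2 * A (Suc k) / lam (Suc k) \<le> A (Suc k) / lam k" by simp
    with Suc one[of "Suc k"] show ?case by (simp add: algebra_simps)
  qed
  have "real (k + 1) * E k = (\<Sum>j\<le>k. E k)" by simp
  also have "\<dots> \<le> (\<Sum>j\<le>k. E j)"
    using E_dec by (intro sum_mono) (auto simp: decseq_def)
  also have "\<dots> \<le> real (k + 1) * d + (\<Sum>j\<le>k. a j) * c + 2 * A 0 / lam 0"
    using sum_le[of k] A_nonneg[of "Suc k"] lam_pos[of k]
    by (smt (verit) divide_nonneg_pos)
  finally have "E k \<le> (real (k + 1) * d + (\<Sum>j\<le>k. a j) * c + 2 * A 0 / lam 0) / real (k + 1)"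
    by (simp add: pos_le_divide_eq mult.commute)
  also have "\<dots> = d + (\<Sum>j\<le>k. a j) * (c / real (k + 1)) + 2 * A 0 / (real (k + 1) * lam 0)"
    by (simp add: add_divide_distrib mult.commute)
  finally show ?thesis .
qed

text \<open>A finite right-hand side makes both summands finite; for \<open>r\<close> this needs
  \<open>l\<close> positive, since zero times infinity is zero in \<open>ennreal\<close>. This moves
  a minimality inequality into the reals.\<close>

lemma ennreal_mult_add_le_realD:
  fixes r b :: ennreal
  assumes "ennreal l * r + b \<le> ennreal m" "0 < l" "0 \<le> m"
  shows "r < \<infinity>" "b < \<infinity>" "l * enn2real r + enn2real b \<le> m"
proof -
  have fin: "ennreal l * r < \<infinity>" "b < \<infinity>"
    using le_less_trans[OF assms(1) ennreal_less_top] by (auto simp: ennreal_add_eq_top less_top)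
  then show "r < \<infinity>" "b < \<infinity>"
    using assms(2) by (auto simp: ennreal_mult_less_top)
  then obtain r' b' where "r = ennreal r'" "0 \<le> r'" "b = ennreal b'" "0 \<le> b'"
    by (metis enn2real_nonneg ennreal_enn2real infinity_ennreal_def)
  then show "l * enn2real r + enn2real b \<le> m"
    using assms by (simp add: ennreal_mult'[symmetric] ennreal_plus[symmetric] del: ennreal_plus)
qed

lemma iterate_eq_mult_prev: "iterate u k = (\<lambda>p. u k p * prev_iterate u k p)"
  by (rule ext) (simp add: iterate_def prev_iterate_def lessThan_Suc_atMost[symmetric] mult.commute)

lemma prev_iterate_0: "prev_iterate u 0 = (\<lambda>p. 1)"
  by (rule ext) (simp add: prev_iterate_def)

lemma prev_iterate_Suc: "prev_iterate u (Suc k) = iterate u k"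
  by (rule ext) (simp add: prev_iterate_def iterate_def lessThan_Suc_atMost)

section \<open>The method at one fixed noise level\<close>

text \<open>Here \<open>g\<close> plays the role of the noisy data for a single
  \<open>\<delta>\<close>. Division by zero gives 0 in HOL, so the clause on \<open>v\<close> being
  nonzero almost everywhere in \<open>J_inverse\<close> is what makes \<open>1 / v\<close> a true
  reciprocal up to null sets.\<close>

locale tight_mhdm_noisy =
  fixes \<Omega> :: "(real^2) set" and T :: "image \<Rightarrow> image" and J :: "image \<Rightarrow> ennreal"
    and H :: "image \<Rightarrow> image \<Rightarrow> ennreal" and f z g :: image and \<delta> :: real
    and lam a :: "nat \<Rightarrow> real" and u :: "nat \<Rightarrow> image"
  assumes T: "bounded_linear_L2 \<Omega> T"
    and J: "functional_on_L2 \<Omega> J"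
    and H: "data_fitting_on_L2 \<Omega> H"
    and f: "f \<in> L2 \<Omega>"
    and z: "z \<in> dom_L2 \<Omega> J" "ae_eq \<Omega> (T z) f"
    and J_mult: "\<And>v w. v \<in> dom_L2 \<Omega> J \<Longrightarrow> w \<in> dom_L2 \<Omega> J \<Longrightarrow>
        (\<lambda>p. v p * w p) \<in> dom_L2 \<Omega> J \<and> J (\<lambda>p. v p * w p) \<le> J v + J w"
    and J_inverse: "\<And>v. v \<in> dom_L2 \<Omega> J \<Longrightarrow>
        (AE p in lebesgue_on \<Omega>. v p \<noteq> 0) \<and> (\<lambda>p. 1 / v p) \<in> dom_L2 \<Omega> J \<and> J v = J (\<lambda>p. 1 / v p)"
    and J_one: "(\<lambda>p. 1) \<in> dom_L2 \<Omega> J" "J (\<lambda>p. 1) = 0"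
    and g: "g \<in> L2 \<Omega>"
    and noise: "H g f \<le> ennreal (\<delta>\<^sup>2)"
    and a_nonneg: "\<And>k. 0 \<le> a k"
    and a_decr: "\<And>k. a (Suc k) \<le> a k"
    and lam_pos: "\<And>k. 0 < lam k"
    and lam_growth: "\<And>k. 2 * lam k \<le> lam (Suc k)"
    and mhdm: "tight_mhdm \<Omega> T J H lam a g u"
begin

abbreviation residual :: "nat \<Rightarrow> ennreal" where
  "residual \<equiv> tight_residual T J H a g u"

text \<open>The competitor z/x_{k-1}, written as a product with a reciprocal so that
  \<open>J_mult\<close> and \<open>J_inverse\<close> apply to it directly.\<close>

definition quot :: "nat \<Rightarrow> image" where
  "quot k p = z p * (1 / prev_iterate u k p)"

lemma J_z_real: "ennreal (enn2real (J z)) = J z"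
  using z(1) by (simp add: dom_L2_def)

lemma tight_functional_minimiser:
  "tight_functional T J H g (lam k) (a k) (prev_iterate u k) (u k)
    = ennreal (lam k) * residual k + J (u k)"
  by (simp add: tight_functional_def tight_residual_def iterate_eq_mult_prev distrib_left mult.assoc)

lemma minimiser_le:
  assumes "v \<in> L2 \<Omega>" "(\<lambda>p. v p * prev_iterate u k p) \<in> L2 \<Omega>"
  shows "tight_functional T J H g (lam k) (a k) (prev_iterate u k) (u k)
    \<le> tight_functional T J H g (lam k) (a k) (prev_iterate u k) v"
  using mhdm assms by (simp add: tight_mhdm_def)

lemma quot_dom:
  assumes "prev_iterate u k \<in> dom_L2 \<Omega> J"
  shows "quot k \<in> dom_L2 \<Omega> J"
  using J_mult[OF z(1), of "\<lambda>p. 1 / prev_iterate u k p"] J_inverse[OF assms]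
  unfolding quot_def[abs_def] by blast

text \<open>The competitor \<open>quot k\<close> turns x_{k-1} back into \<open>z\<close>, whose
  data term is at most the squared noise level.\<close>

lemma tight_functional_quot_le:
  assumes x: "prev_iterate u k \<in> dom_L2 \<Omega> J"
  shows "ennreal (lam k) * residual k + J (u k)
    \<le> ennreal (lam k * (\<delta>\<^sup>2 + a k * enn2real (J z)) + enn2real (J (quot k)))"
proof -
  let ?y = "\<lambda>p. quot k p * prev_iterate u k p"
  have y: "?y \<in> dom_L2 \<Omega> J" using J_mult[OF quot_dom[OF x] x] by blast
  have q: "quot k \<in> L2 \<Omega>" "J (quot k) = ennreal (enn2real (J (quot k)))"
    using quot_dom[OF x] by (auto simp: dom_L2_def)
  have L2: "?y \<in> L2 \<Omega>" "z \<in> L2 \<Omega>" using y z by (auto simp: dom_L2_def)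
  \<comment> \<open>At zeros of x_{k-1} the product is 0 rather than \<open>z\<close>. These zeros
    form a null set, so the invariance of \<open>T\<close>, \<open>H\<close> and \<open>J\<close>
    under almost-everywhere equality closes the gap.\<close>
  have "AE p in lebesgue_on \<Omega>. prev_iterate u k p \<noteq> 0" using J_inverse[OF x] by blast
  then have ae: "ae_eq \<Omega> ?y z" unfolding ae_eq_def quot_def by eventually_elim simp
  have "ae_eq \<Omega> (T ?y) (T z)" and Ty: "T ?y \<in> L2 \<Omega>"
    using T L2 ae unfolding bounded_linear_L2_def by blast+
  then have "ae_eq \<Omega> (T ?y) f"
    using z(2) unfolding ae_eq_def by (auto elim: AE_mp)
  moreover have "ae_eq \<Omega> g g" by (simp add: ae_eq_def)
  ultimately have "H g (T ?y) = H g f"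
    using H g f Ty unfolding data_fitting_on_L2_def by blast
  moreover have "J ?y = J z" using J L2 ae unfolding functional_on_L2_def by blast
  moreover have "tight_functional T J H g (lam k) (a k) (prev_iterate u k) (u k)
      \<le> tight_functional T J H g (lam k) (a k) (prev_iterate u k) (quot k)"
    using q L2 by (intro minimiser_le) auto
  ultimately have "ennreal (lam k) * residual k + J (u k)
      \<le> ennreal (lam k) * (H g f + ennreal (a k) * J z) + J (quot k)"
    unfolding tight_functional_minimiser by (simp add: tight_functional_def distrib_left mult.assoc)
  also have "\<dots> \<le> ennreal (lam k) * (ennreal (\<delta>\<^sup>2) + ennreal (a k) * J z) + J (quot k)"
    using noise by (intro add_mono mult_left_mono) auto
  also have "\<dots> = ennreal (lam k) * (ennreal (\<delta>\<^sup>2) + ennreal (a k) * ennreal (enn2real (J z)))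
      + ennreal (enn2real (J (quot k)))"
    using q(2) J_z_real by simp
  also have "\<dots> = ennreal (lam k * (\<delta>\<^sup>2 + a k * enn2real (J z)) + enn2real (J (quot k)))"
    using lam_pos[of k] a_nonneg[of k]
    by (simp add: ennreal_mult[symmetric] ennreal_plus[symmetric] del: ennreal_plus)
  finally show ?thesis .
qed

text \<open>The comparison value is finite, hence so are the residual and J(u_k). The resulting
  membership of \<open>u k\<close> in the domain of \<open>J\<close> drives the induction for
  \<open>prev_iterate_dom\<close>.\<close>

lemma step:
  assumes x: "prev_iterate u k \<in> dom_L2 \<Omega> J"
  shows "residual k < \<infinity>" "u k \<in> dom_L2 \<Omega> J"
    "lam k * enn2real (residual k) + enn2real (J (u k))
      \<le> lam k * (\<delta>\<^sup>2 + a k * enn2real (J z)) + enn2real (J (quot k))"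
proof -
  have "0 \<le> lam k * (\<delta>\<^sup>2 + a k * enn2real (J z)) + enn2real (J (quot k))"
    using lam_pos[of k] a_nonneg[of k] by simp
  note * = ennreal_mult_add_le_realD[OF tight_functional_quot_le[OF x] lam_pos this]
  show "residual k < \<infinity>" by (rule *)
  show "u k \<in> dom_L2 \<Omega> J" using *(2) mhdm by (auto simp: dom_L2_def tight_mhdm_def)
  show "lam k * enn2real (residual k) + enn2real (J (u k))
      \<le> lam k * (\<delta>\<^sup>2 + a k * enn2real (J z)) + enn2real (J (quot k))" by (rule *)
qed

lemma prev_iterate_dom: "prev_iterate u k \<in> dom_L2 \<Omega> J"
proof (induction k)
  case 0
  then show ?case using J_one by (simp add: prev_iterate_0)
next
  case (Suc k)
  then show ?case using J_mult[OF step(2)[OF Suc] Suc]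
    unfolding prev_iterate_Suc iterate_eq_mult_prev by blast
qed

lemma J_quot_Suc: "enn2real (J (quot (Suc k))) \<le> enn2real (J (quot k)) + enn2real (J (u k))"
proof -
  have inv: "(\<lambda>p. 1 / u k p) \<in> dom_L2 \<Omega> J" "J (u k) = J (\<lambda>p. 1 / u k p)"
    using J_inverse[OF step(2)[OF prev_iterate_dom]] by auto
  \<comment> \<open>With 1/0 = 0 the reciprocal of a product is the product of the reciprocals even
    at zeros, so this identity holds at every point.\<close>
  have "quot (Suc k) = (\<lambda>p. quot k p * (1 / u k p))"
    by (rule ext) (simp add: quot_def prev_iterate_Suc iterate_eq_mult_prev)
  then have "J (quot (Suc k)) \<le> J (quot k) + J (u k)"
    using J_mult[OF quot_dom[OF prev_iterate_dom] inv(1)] inv(2) by simp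
  moreover have "J (quot k) < \<infinity>" "J (u k) < \<infinity>"
    using quot_dom[OF prev_iterate_dom, of k] step(2)[OF prev_iterate_dom, of k] 
    by (auto simp: dom_L2_def)
  ultimately show ?thesis
    by (metis enn2real_mono enn2real_plus ennreal_add_less_top infinity_ennreal_def)
qed

text \<open>The competitor 1 leaves the iterate unchanged and costs nothing because J(1) = 0;
  replacing \<open>a (Suc k)\<close> by the larger \<open>a k\<close> then recovers the previous
  residual.\<close>

lemma residual_Suc_le: "residual (Suc k) \<le> residual k"
proof -
  let ?x = "iterate u k" and ?l = "ennreal (lam (Suc k))"
  have x: "(\<lambda>p. 1 * prev_iterate u (Suc k) p) \<in> L2 \<Omega>"
    using prev_iterate_dom[of "Suc k"] by (simp add: dom_L2_def)
  have one: "(\<lambda>p. 1) \<in> L2 \<Omega>" using J_one by (simp add: dom_L2_def)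
  have "?l * residual (Suc k) \<le> ?l * residual (Suc k) + J (u (Suc k))" by simp
  also have "\<dots> \<le> tight_functional T J H g (lam (Suc k)) (a (Suc k)) (prev_iterate u (Suc k)) (\<lambda>p. 1)"
    unfolding tight_functional_minimiser[symmetric] by (rule minimiser_le[OF one x])
  also have "\<dots> = ?l * (H g (T ?x) + ennreal (a (Suc k)) * J ?x)"
    using J_one by (simp add: tight_functional_def prev_iterate_Suc distrib_left mult.assoc)
  also have "\<dots> \<le> ?l * residual k"
    unfolding tight_residual_def
    using a_decr[of k] by (intro mult_left_mono add_mono mult_right_mono ennreal_leI) auto
  finally show ?thesis
    using lam_pos[of "Suc k"] by (simp add: ennreal_mult_le_mult_iff)
qed

lemma residual_le:
  "residual k \<le> ennreal (\<delta>\<^sup>2 + (\<Sum>j\<le>k. a j) * (enn2real (J z) / real (k + 1))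
      + 2 * enn2real (J z) / (real (k + 1) * lam 0))"
proof -
  \<comment> \<open>\<open>enn2real\<close> sends infinity to 0, so finiteness is needed before
    monotonicity can be carried over to real values.\<close>
  have fin: "residual k < \<infinity>" for k using step(1)[OF prev_iterate_dom] .
  have "decseq (\<lambda>k. enn2real (residual k))"
    using fin residual_Suc_le by (intro decseq_SucI enn2real_mono) auto
  \<comment> \<open>Since x_{-1} = 1, the initial value \<open>A 0\<close> of the telescoping is
    J(z).\<close>
  moreover have "quot 0 = z" by (rule ext) (simp add: quot_def prev_iterate_0)
  ultimately have "enn2real (residual k) \<le> \<delta>\<^sup>2 + (\<Sum>j\<le>k. a j) * (enn2real (J z) / real (k + 1))
      + 2 * enn2real (J z) / (real (k + 1) * lam 0)"
    using decseq_telescope_bound[of lam "\<lambda>k. enn2real (residual k)" "\<lambda>k. enn2real (J (u k))" "\<delta>\<^sup>2" a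
        "enn2real (J z)" "\<lambda>k. enn2real (J (quot k))" k]
      step(3)[OF prev_iterate_dom] J_quot_Suc lam_pos lam_growth by simp
  then show ?thesis
    using fin[of k] ennreal_leI by fastforce
qed

text \<open>Replacing the partial sums of \<open>a\<close> by the full sum leaves a bound of the
  form \<open>\<delta>\<close> squared plus C / (k + 1), with C independent of both k and
  \<open>\<delta>\<close>. All asymptotic claims rest on this form.\<close>

lemma residual_le_summable:
  assumes "summable a"
  shows "residual k
    \<le> ennreal (\<delta>\<^sup>2 + (suminf a * enn2real (J z) + 2 * enn2real (J z) / lam 0) / real (k + 1))"
proof -
  have "(\<Sum>j\<le>k. a j) * (enn2real (J z) / real (k + 1)) \<le> suminf a * (enn2real (J z) / real (k + 1))"
    using assms a_nonneg by (intro mult_right_mono sum_le_suminf) auto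
  then show ?thesis
    by (intro order.trans[OF residual_le] ennreal_leI) (simp add: add_divide_distrib mult.commute)
qed

end

section \<open>Stopping sets and squeezing\<close>

text \<open>The lower bound defining the stopping set meets the upper bound C / (k + 1). The result
  is used in two directions: for fixed \<open>\<delta>\<close> it bounds the index, and for a large
  index it forces \<open>\<delta>\<close> to be small.\<close>

lemma stopping_set_boundedD:
  assumes le: "\<And>k. tight_residual T J H a g u k \<le> ennreal (\<delta>\<^sup>2 + C / real (k + 1))"
    and C: "0 \<le> C" and k: "k \<in> stopping_set T J H a g u \<tau> \<delta>"
  shows "(\<tau> - 1) * \<delta>\<^sup>2 \<le> C / real (k + 1)"
proof -
  have "ennreal (\<tau> * \<delta>\<^sup>2) \<le> ennreal (\<delta>\<^sup>2 + C / real (k + 1))"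
    using k le[of k] by (auto simp: stopping_set_def)
  then have "\<tau> * \<delta>\<^sup>2 \<le> \<delta>\<^sup>2 + C / real (k + 1)"
    using C by (subst (asm) ennreal_le_iff) auto
  then show ?thesis by (simp add: algebra_simps)
qed

lemma finite_stopping_set:
  assumes le: "\<And>k. tight_residual T J H a g u k \<le> ennreal (\<delta>\<^sup>2 + C / real (k + 1))"
    and C: "0 \<le> C" and "1 < \<tau>" "0 < \<delta>"
  shows "finite (stopping_set T J H a g u \<tau> \<delta>)"
proof (rule finite_subset)
  have pos: "0 < (\<tau> - 1) * \<delta>\<^sup>2" using assms by simp
  show "stopping_set T J H a g u \<tau> \<delta> \<subseteq> {..nat \<lceil>C / ((\<tau> - 1) * \<delta>\<^sup>2)\<rceil>}"
  proof
    fix k assume "k \<in> stopping_set T J H a g u \<tau> \<delta>"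
    then have "(\<tau> - 1) * \<delta>\<^sup>2 \<le> C / real (k + 1)" by (rule stopping_set_boundedD[OF le C])
    then have "real (k + 1) \<le> C / ((\<tau> - 1) * \<delta>\<^sup>2)"
      using pos by (simp add: pos_le_divide_eq mult.commute)
    then show "k \<in> {..nat \<lceil>C / ((\<tau> - 1) * \<delta>\<^sup>2)\<rceil>}"
      by simp linarith
  qed
qed simp

lemma tendsto_0_of_add_le:
  fixes p q :: "'b \<Rightarrow> ennreal" and e :: "'b \<Rightarrow> real"
  assumes "\<forall>\<^sub>F i in F. p i + q i \<le> ennreal (e i)" "(e \<longlongrightarrow> 0) F"
  shows "(p \<longlongrightarrow> 0) F" "(q \<longlongrightarrow> 0) F"
proof -
  have lim: "((\<lambda>i. ennreal (e i)) \<longlongrightarrow> 0) F"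
    using tendsto_ennrealI[OF assms(2)] by simp
  have "\<forall>\<^sub>F i in F. p i \<le> ennreal (e i)" "\<forall>\<^sub>F i in F. q i \<le> ennreal (e i)"
    using assms(1) by (eventually_elim, meson add_increasing2 add_increasing order.trans order_refl zero_le)+
  then show "(p \<longlongrightarrow> 0) F" "(q \<longlongrightarrow> 0) F"
    using tendsto_sandwich[OF _ _ tendsto_const lim] by auto
qed

section \<open>All noise levels together: estimate, stopping index and limits\<close>

theorem proposition5p2:
  fixes \<Omega> :: "(real^2) set"
    and T :: "image \<Rightarrow> image"
    and J :: "image \<Rightarrow> ennreal"
    and H :: "image \<Rightarrow> image \<Rightarrow> ennreal"
    and f z :: image
    and D :: "real set" \<comment> \<open>the noise levels under consideration\<close>
    and fd :: "real \<Rightarrow> image"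
    and lam a :: "nat \<Rightarrow> real"
    and u :: "real \<Rightarrow> nat \<Rightarrow> image"
    and \<tau> :: real
  defines "x \<equiv> \<lambda>\<delta>. iterate (u \<delta>)"
    and "kstar \<equiv> \<lambda>\<delta>. stopping_index T J H a (fd \<delta>) (u \<delta>) \<tau> \<delta>"
  assumes domain: "open \<Omega>" "connected \<Omega>" "\<Omega> \<noteq> {}"
    and T: "bounded_linear_L2 \<Omega> T"
    and J: "functional_on_L2 \<Omega> J"
    and J_proper: "dom_L2 \<Omega> J \<noteq> {}"
    and H: "data_fitting_on_L2 \<Omega> H"
    and f: "f \<in> L2 \<Omega>"
    and z: "z \<in> dom_L2 \<Omega> J" "ae_eq \<Omega> (T z) f"
    and J_mult: "\<And>v w. v \<in> dom_L2 \<Omega> J \<Longrightarrow> w \<in> dom_L2 \<Omega> J \<Longrightarrow>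
        (\<lambda>p. v p * w p) \<in> dom_L2 \<Omega> J \<and> J (\<lambda>p. v p * w p) \<le> J v + J w"
    and J_inverse: "\<And>v. v \<in> dom_L2 \<Omega> J \<Longrightarrow>
        (AE p in lebesgue_on \<Omega>. v p \<noteq> 0) \<and> (\<lambda>p. 1 / v p) \<in> dom_L2 \<Omega> J \<and> J v = J (\<lambda>p. 1 / v p)"
    and J_one: "(\<lambda>p. 1) \<in> dom_L2 \<Omega> J" "J (\<lambda>p. 1) = 0"
    and D: "D \<subseteq> {0<..}"
    and fd: "\<And>\<delta>. \<delta> \<in> D \<Longrightarrow> fd \<delta> \<in> L2 \<Omega>"
    and noise: "\<And>\<delta>. \<delta> \<in> D \<Longrightarrow> H (fd \<delta>) f \<le> ennreal (\<delta>\<^sup>2)"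
    and a_nonneg: "\<And>k. 0 \<le> a k"
    and a_lim: "a \<longlonglongrightarrow> 0"
    and a_decr: "\<And>k. a (Suc k) \<le> a k"
    and lam_pos: "\<And>k. 0 < lam k"
    and lam_growth: "\<And>k. 2 * lam k \<le> lam (Suc k)"
    and mhdm: "\<And>\<delta>. \<delta> \<in> D \<Longrightarrow> tight_mhdm \<Omega> T J H lam a (fd \<delta>) (u \<delta>)"
    and tau: "1 < \<tau>"
  shows
    "(\<forall>\<delta>\<in>D. \<forall>k. H (fd \<delta>) (T (x \<delta> k)) + ennreal (a k) * J (x \<delta> k)
        \<le> ennreal (\<delta>\<^sup>2) + ennreal (\<Sum>j\<le>k. a j) * (J z / ennreal (real (k + 1)))
           + 2 * J z / ennreal (real (k + 1) * lam 0))
     \<and> (summable a \<longrightarrow>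
          (\<forall>\<delta>\<in>D. finite (stopping_set T J H a (fd \<delta>) (u \<delta>) \<tau> \<delta>))
          \<and> (filterlim kstar at_top (at 0 within D) \<longrightarrow>
               ((\<lambda>\<delta>. H (fd \<delta>) (T (x \<delta> (kstar \<delta>)))) \<longlongrightarrow> 0) (at 0 within D)
               \<and> ((\<lambda>\<delta>. ennreal (a (kstar \<delta>)) * J (x \<delta> (kstar \<delta>))) \<longlongrightarrow> 0) (at 0 within D))
          \<and> (\<not> bdd_above (kstar ` D) \<longrightarrow>
               (\<exists>s. (\<forall>n. s n \<in> D) \<and> s \<longlonglongrightarrow> 0 \<and> filterlim (\<lambda>n. kstar (s n)) at_top sequentially
                  \<and> (\<lambda>n. H (fd (s n)) (T (x (s n) (kstar (s n))))) \<longlonglongrightarrow> 0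
                  \<and> (\<lambda>n. ennreal (a (kstar (s n))) * J (x (s n) (kstar (s n)))) \<longlonglongrightarrow> 0))
          \<and> (\<forall>\<kappa>::real \<Rightarrow> nat. (\<lambda>\<delta>. real (\<kappa> \<delta>)) \<in> \<Theta>[at 0 within D](\<lambda>\<delta>. 1 / \<delta>\<^sup>2) \<longrightarrow>
               (\<exists>C\<ge>0. \<forall>\<^sub>F \<delta> in at 0 within D.
                  H (fd \<delta>) (T (x \<delta> (\<kappa> \<delta>))) + ennreal (a (\<kappa> \<delta>)) * J (x \<delta> (\<kappa> \<delta>))
                    \<le> ennreal (C * \<delta>\<^sup>2))))"
proof -
  have setting: "tight_mhdm_noisy \<Omega> T J H f z (fd \<delta>) \<delta> lam a (u \<delta>)" if "\<delta> \<in> D" for \<delta>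
    by unfold_locales (fact T J H f z J_mult J_inverse J_one fd[OF that] noise[OF that] a_nonneg
        a_decr lam_pos lam_growth mhdm[OF that])+
  define R where "R = (\<lambda>\<delta>. tight_residual T J H a (fd \<delta>) (u \<delta>))"
  have R: "H (fd \<delta>) (T (x \<delta> k)) + ennreal (a k) * J (x \<delta> k) = R \<delta> k" for \<delta> k
    by (simp add: R_def tight_residual_def x_def)
  define Jz where "Jz = enn2real (J z)"
  have Jz: "J z = ennreal Jz" "0 \<le> Jz"
    using z(1) by (auto simp: Jz_def dom_L2_def)
  have bound: "R \<delta> k \<le> ennreal (\<delta>\<^sup>2) + ennreal (\<Sum>j\<le>k. a j) * (J z / ennreal (real (k + 1)))
           + 2 * J z / ennreal (real (k + 1) * lam 0)" if "\<delta> \<in> D" for \<delta> k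
  proof -
    \<comment> \<open>J(z) is finite and the denominators are positive, so the extended right-hand
      side collapses to a single real number, the one in \<open>residual_le\<close>.\<close>
    have "2 * J z = ennreal (2 * Jz)"
      using Jz by (simp add: ennreal_mult')
    moreover have "0 \<le> (\<Sum>j\<le>k. a j)" using a_nonneg by (simp add: sum_nonneg)
    ultimately have "ennreal (\<delta>\<^sup>2) + ennreal (\<Sum>j\<le>k. a j) * (J z / ennreal (real (k + 1)))
           + 2 * J z / ennreal (real (k + 1) * lam 0)
        = ennreal (\<delta>\<^sup>2 + (\<Sum>j\<le>k. a j) * (Jz / real (k + 1)) + 2 * Jz / (real (k + 1) * lam 0))"
      using Jz lam_pos[of 0]
      by (simp add: divide_ennreal ennreal_mult[symmetric] ennreal_plus[symmetric] del: ennreal_plus)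
    then show ?thesis
      using tight_mhdm_noisy.residual_le[OF setting[OF that], of k] by (simp add: R_def Jz_def)
  qed
  have limits: "(\<forall>\<delta>\<in>D. finite (stopping_set T J H a (fd \<delta>) (u \<delta>) \<tau> \<delta>))
          \<and> (filterlim kstar at_top (at 0 within D) \<longrightarrow>
               ((\<lambda>\<delta>. H (fd \<delta>) (T (x \<delta> (kstar \<delta>)))) \<longlongrightarrow> 0) (at 0 within D)
               \<and> ((\<lambda>\<delta>. ennreal (a (kstar \<delta>)) * J (x \<delta> (kstar \<delta>))) \<longlongrightarrow> 0) (at 0 within D))
          \<and> (\<not> bdd_above (kstar ` D) \<longrightarrow>
               (\<exists>s. (\<forall>n. s n \<in> D) \<and> s \<longlonglongrightarrow> 0 \<and> filterlim (\<lambda>n. kstar (s n)) at_top sequentially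
                  \<and> (\<lambda>n. H (fd (s n)) (T (x (s n) (kstar (s n))))) \<longlonglongrightarrow> 0
                  \<and> (\<lambda>n. ennreal (a (kstar (s n))) * J (x (s n) (kstar (s n)))) \<longlonglongrightarrow> 0))
          \<and> (\<forall>\<kappa>::real \<Rightarrow> nat. (\<lambda>\<delta>. real (\<kappa> \<delta>)) \<in> \<Theta>[at 0 within D](\<lambda>\<delta>. 1 / \<delta>\<^sup>2) \<longrightarrow>
               (\<exists>C\<ge>0. \<forall>\<^sub>F \<delta> in at 0 within D. R \<delta> (\<kappa> \<delta>) \<le> ennreal (C * \<delta>\<^sup>2)))"
    if sum: "summable a"
  proof (intro conjI impI allI ballI)
    \<comment> \<open>The constant of \<open>residual_le_summable\<close>; it involves only
      \<open>a\<close>, \<open>lam\<close> and J(z), so it is shared by all noise levels.\<close>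
    define C where "C = suminf a * Jz + 2 * Jz / lam 0"
    have C: "0 \<le> C"
      using Jz(2) lam_pos[of 0] suminf_nonneg[OF sum a_nonneg] by (simp add: C_def)
    have R_le: "R \<delta> k \<le> ennreal (\<delta>\<^sup>2 + C / real (k + 1))" if "\<delta> \<in> D" for \<delta> k
      using tight_mhdm_noisy.residual_le_summable[OF setting[OF that] sum]
      by (simp add: R_def C_def Jz_def)
    have pos: "0 < \<delta>" if "\<delta> \<in> D" for \<delta> using that D by auto
    show fin: "finite (stopping_set T J H a (fd \<delta>) (u \<delta>) \<tau> \<delta>)" if "\<delta> \<in> D" for \<delta>
      using finite_stopping_set[OF R_le[OF that, unfolded R_def] C tau pos[OF that]] .
    \<comment> \<open>Stated for a family \<open>t\<close> of noise levels along any filter, to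
      cover both the full limit at 0 within \<open>D\<close> and the limit along a sequence.\<close>
    have lim: "((\<lambda>i. H (fd (t i)) (T (x (t i) (kstar (t i))))) \<longlongrightarrow> 0) F"
              "((\<lambda>i. ennreal (a (kstar (t i))) * J (x (t i) (kstar (t i)))) \<longlongrightarrow> 0) F"
      if t: "\<forall>\<^sub>F i in F. t i \<in> D" "(t \<longlongrightarrow> 0) F" and k: "filterlim (\<lambda>i. kstar (t i)) at_top F"
      for t :: "'i \<Rightarrow> real" and F
    proof -
      have le: "\<forall>\<^sub>F i in F. H (fd (t i)) (T (x (t i) (kstar (t i))))
          + ennreal (a (kstar (t i))) * J (x (t i) (kstar (t i)))
          \<le> ennreal ((t i)\<^sup>2 + C / real (kstar (t i) + 1))"
        using t(1) unfolding R by eventually_elim (rule R_le)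
      have "filterlim (\<lambda>i. 1 + real (kstar (t i))) at_top F"
        by (intro filterlim_tendsto_add_at_top[OF tendsto_const]
            filterlim_compose[OF filterlim_real_sequentially k])
      then have "((\<lambda>i. C / (1 + real (kstar (t i)))) \<longlongrightarrow> 0) F"
        by (intro real_tendsto_divide_at_top[OF tendsto_const])
      then have "((\<lambda>i. (t i)\<^sup>2 + C / real (kstar (t i) + 1)) \<longlongrightarrow> 0) F"
        using tendsto_add[OF tendsto_power[OF t(2), of 2]] by (fastforce simp: add.commute)
      from tendsto_0_of_add_le[OF le this] show
        "((\<lambda>i. H (fd (t i)) (T (x (t i) (kstar (t i))))) \<longlongrightarrow> 0) F"
        "((\<lambda>i. ennreal (a (kstar (t i))) * J (x (t i) (kstar (t i)))) \<longlongrightarrow> 0) F" .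
    qed
    have in_D: "\<forall>\<^sub>F \<delta> in at 0 within D. \<delta> \<in> D"
      by (simp add: eventually_at_filter)
    show "((\<lambda>\<delta>. H (fd \<delta>) (T (x \<delta> (kstar \<delta>)))) \<longlongrightarrow> 0) (at 0 within D)"
      "((\<lambda>\<delta>. ennreal (a (kstar \<delta>)) * J (x \<delta> (kstar \<delta>))) \<longlongrightarrow> 0) (at 0 within D)"
      if "filterlim kstar at_top (at 0 within D)"
      using lim[OF in_D tendsto_ident_at that] by auto
    show "\<exists>s. (\<forall>n. s n \<in> D) \<and> s \<longlonglongrightarrow> 0 \<and> filterlim (\<lambda>n. kstar (s n)) at_top sequentially
                  \<and> (\<lambda>n. H (fd (s n)) (T (x (s n) (kstar (s n))))) \<longlonglongrightarrow> 0
                  \<and> (\<lambda>n. ennreal (a (kstar (s n))) * J (x (s n) (kstar (s n)))) \<longlonglongrightarrow> 0"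
      if unbdd: "\<not> bdd_above (kstar ` D)"
    proof -
      \<comment> \<open>Here \<open>kstar\<close> is only known to be unbounded on \<open>D\<close>,
        so a sequence of noise levels with growing stopping index is extracted; its convergence to 0
        has to be proved.\<close>
      have "\<exists>\<delta>\<in>D. n < kstar \<delta>" for n
        using unbdd by (auto simp: bdd_above_def not_le)
      then obtain s where s: "\<And>n. s n \<in> D" "\<And>n. n < kstar (s n)" by metis
      have top: "filterlim (\<lambda>n. kstar (s n)) at_top sequentially"
        by (rule filterlim_at_top_mono[OF filterlim_ident]) (simp add: s(2) less_imp_le)
      have sq_le: "(s n)\<^sup>2 \<le> C / (\<tau> - 1) * inverse (real (Suc n))" for n
      proof -
        let ?S = "stopping_set T J H a (fd (s n)) (u (s n)) \<tau> (s n)"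
        \<comment> \<open>The strict inequality \<open>n < kstar (s n)\<close> excludes the default
          value 0 of an empty stopping set, so the index is a genuine maximum and belongs to the
          set.\<close>
        have "?S \<noteq> {}" "kstar (s n) = Max ?S"
          using s(2)[of n] by (auto simp: kstar_def stopping_index_def split: if_splits)
        then have "kstar (s n) \<in> ?S" using Max_in[OF fin[OF s(1)[of n]]] by simp
        then have "(\<tau> - 1) * (s n)\<^sup>2 \<le> C / real (kstar (s n) + 1)"
          by (rule stopping_set_boundedD[OF R_le[OF s(1), unfolded R_def] C])
        also have "\<dots> \<le> C / real (Suc n)"
          using s(2)[of n] C by (intro divide_left_mono) auto
        finally have "(s n)\<^sup>2 \<le> C / real (Suc n) / (\<tau> - 1)"
          using tau by (subst pos_le_divide_eq) (auto simp: mult.commute)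
        then show ?thesis by (simp add: divide_inverse mult_ac)
      qed
      have "(\<lambda>n. C / (\<tau> - 1) * inverse (real (Suc n))) \<longlonglongrightarrow> 0"
        using tendsto_mult_right_zero[OF LIMSEQ_inverse_real_of_nat] .
      then have "(\<lambda>n. (s n)\<^sup>2) \<longlonglongrightarrow> 0"
        by (rule tendsto_sandwich[OF always_eventually always_eventually tendsto_const, rotated -1])
          (simp_all only: zero_le_power2 sq_le simp_thms)
      then have "s \<longlonglongrightarrow> 0"
        by (rule power_tendsto_0_iff[THEN iffD1, rotated]) simp
      then show ?thesis using lim[of s sequentially] s(1) top by auto
    qed
    show "\<exists>C\<ge>0. \<forall>\<^sub>F \<delta> in at 0 within D. R \<delta> (\<kappa> \<delta>) \<le> ennreal (C * \<delta>\<^sup>2)"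
      if "(\<lambda>\<delta>. real (\<kappa> \<delta>)) \<in> \<Theta>[at 0 within D](\<lambda>\<delta>. 1 / \<delta>\<^sup>2)" for \<kappa> :: "real \<Rightarrow> nat"
    proof -
      from that have "(\<lambda>\<delta>. real (\<kappa> \<delta>)) \<in> \<Omega>[at 0 within D](\<lambda>\<delta>. 1 / \<delta>\<^sup>2)"
        by (rule bigthetaD2)
      then obtain c where c: "0 < c"
        "\<forall>\<^sub>F \<delta> in at 0 within D. norm (real (\<kappa> \<delta>)) \<ge> c * norm (1 / \<delta>\<^sup>2)"
        by (elim landau_omega.bigE)
      \<comment> \<open>The lower half of the order relation, \<open>\<kappa> \<delta>\<close> at
        least c over \<open>\<delta>\<close> squared, bounds C / (\<open>\<kappa> \<delta>\<close> +
        1) by C / c times \<open>\<delta>\<close> squared; the 1 in the constant accounts for the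
        noise term.\<close>
      from c(2) in_D have "\<forall>\<^sub>F \<delta> in at 0 within D. R \<delta> (\<kappa> \<delta>) \<le> ennreal ((1 + C / c) * \<delta>\<^sup>2)"
      proof eventually_elim
        case (elim \<delta>)
        have "c / \<delta>\<^sup>2 \<le> real (\<kappa> \<delta> + 1)" using elim(1) by simp
        then have "C / real (\<kappa> \<delta> + 1) \<le> C / (c / \<delta>\<^sup>2)"
          using C c(1) pos[OF elim(2)] by (intro divide_left_mono) auto
        then have "\<delta>\<^sup>2 + C / real (\<kappa> \<delta> + 1) \<le> (1 + C / c) * \<delta>\<^sup>2"
          by (simp add: algebra_simps)
        then show ?case using R_le[OF elim(2)] ennreal_leI order.trans by blast
      qed
      moreover have "0 \<le> 1 + C / c" using C c(1) by simp
      ultimately show ?thesis by blast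
    qed
  qed
  show ?thesis
    unfolding R by (intro conjI[OF _ impI] ballI allI) (rule bound, assumption, rule limits)
qed

end
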